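(* Suppose $\mathcal{C}$ is a $*$-preserving, deterministically reasonable, and strictly positive (even) subcategory of a quantum Markov category. Then $\mathcal{C}$ is a.e. modular and S-positive.
   Context: A $\mathbb{Z}_2$-monoidal category is a category in which every morphism has a grade in $\mathbb{Z}_2=\{0,1\}$ ($0$ = even, $1$ = odd), identities being even and grades adding under composition, such that for each object $X$ and each grade there is an isomorphism with source $X$ of that grade; together with a tensor product assigning $X\otimes Y$ to objects and $f\otimes f'$ (of the common grade) to pairs of morphisms of equal grade, functorially; a unit object $I$ with a chosen odd involution $*_I$ of $I$; and even natural isomorphisms (associator, symmetry $c_{X,Y}:X\otimes Y\to Y\otimes X$, unitor $I\otimes X\to X$) satisfying the usual axioms of a symmetric monoidal category. Associators and unitors are suppressed. A quantum CD category is a $\mathbb{Z}_2$-monoidal category with, for each object $X$, even morphisms $\Delta_X:X\to X\otimes X$, $!_X:X\to I$ and an odd morphism $*_X:X\to X$ such that: $(!_X\otimes\mathrm{id})\Delta_X=\mathrm{id}_X=(\mathrm{id}\otimes{!_X})\Delta_X$; $(\Delta_X\otimes\mathrm{id})\Delta_X=(\mathrm{id}\otimes\Delta_X)\Delta_X$; $c_{X,X}( *_X\otimes*_X)\Delta_X=\Delta_X*_X$; $!_{X\otimes Y}={!_X}\otimes{!_Y}$; $!_I=\mathrm{id}_I$; $\Delta_{X\otimes Y}=(\mathrm{id}_X\otimes c_{X,Y}\otimes\mathrm{id}_Y)(\Delta_X\otimes\Delta_Y)$; $\Delta_I=\mathrm{id}_I$; $*_X*_X=\mathrm{id}_X$;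 $*_{X\otimes Y}=*_X\otimes*_Y$; $!_X*_X=*_I\,!_X$. It is a quantum Markov category if moreover every even $f:X\to Y$ satisfies $!_Y f={!_X}$ and every odd $f:X\to Y$ satisfies $!_Yf={!_X}*_X$. A morphism $f:X\to Y$ is $*$-preserving if $f*_X=*_Yf$; a subcategory is $*$-preserving (even) if all its morphisms are. An even $f:X\to Y$ is deterministic if it is $*$-preserving and $\Delta_Yf=(f\otimes f)\Delta_X$. For $p:\Theta\to X$ and even $f,g:X\to Y$: $f$ is left (right) $p$-a.e. equivalent to $g$ if $(f\otimes\mathrm{id}_X)\Delta_Xp=(g\otimes\mathrm{id}_X)\Delta_Xp$ (respectively $(\mathrm{id}_X\otimes f)\Delta_Xp=(\mathrm{id}_X\otimes g)\Delta_Xp$). $f$ is left $p$-a.e. deterministic if $(f\otimes f\otimes\mathrm{id}_X)(\Delta_X\otimes\mathrm{id}_X)\Delta_Xp=((\Delta_Yf)\otimes\mathrm{id}_X)\Delta_Xp$, and right $p$-a.e. deterministic if $(\mathrm{id}_X\otimes f\otimes f)(\mathrm{id}_X\otimes\Delta_X)\Delta_Xp=(\mathrm{id}_X\otimes(\Delta_Yf))\Delta_Xp$. $\mathcal{C}$ is deterministically reasonable if whenever $f,p$ in $\mathcal{C}$ are such that $f$ is right (left) $p$-a.e. equivalent to a deterministic morphism, then $f$ is right (left) $p$-a.e. deterministic. $\mathcal{C}$ is left strictly positive if for all $q:\Theta\to Y$, $g:Y\to X$, $f:X\to Z$ in $\mathcal{C}$ such that $f g$ is left $q$-a.e. deterministic,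 $(\mathrm{id}_X\otimes f\otimes\mathrm{id}_Y)((\Delta_Xg)\otimes\mathrm{id}_Y)\Delta_Yq=(g\otimes(fg)\otimes\mathrm{id}_Y)(\Delta_Y\otimes\mathrm{id}_Y)\Delta_Yq$. $\mathcal{C}$ is left a.e. modular if for all $f:X\to Y$, $g:Y\to X$, $q:\Theta\to Y$ in $\mathcal{C}$ with $fg$ left $q$-a.e. equivalent to $\mathrm{id}_Y$, $(\mathrm{id}_X\otimes f\otimes\mathrm{id}_Y)((\Delta_Xg)\otimes\mathrm{id}_Y)\Delta_Yq=(g\otimes\mathrm{id}_Y\otimes\mathrm{id}_Y)(\Delta_Y\otimes\mathrm{id}_Y)\Delta_Yq$. Right versions are mirror images (tensor order reversed); for even $*$-preserving subcategories left and right versions are equivalent and the adjective is dropped. $\mathcal{C}$ is S-positive if for every composable pair $X\xrightarrow{f}Y\xrightarrow{g}Z$ in $\mathcal{C}$ with $gf$ deterministic, $(g\otimes\mathrm{id}_Y)\Delta_Yf=((gf)\otimes f)\Delta_X$. *)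

theory Defs
  imports Main "HOL-Library.Z2"
begin

section \<open>Z2-monoidal categories\<close>

record ('o, 'm) category =
  Obj :: "'o set"
  Arr :: "'m set"
  src :: "'m \<Rightarrow> 'o"
  tgt :: "'m \<Rightarrow> 'o"
  ident :: "'o \<Rightarrow> 'm" ("\<one>\<index>")
  comp :: "'m \<Rightarrow> 'm \<Rightarrow> 'm" (infixl "\<cdot>\<index>" 70)

definition hom :: "('o, 'm, 'x) category_scheme \<Rightarrow> 'o \<Rightarrow> 'o \<Rightarrow> 'm set" where
  "hom Q X Y = {f \<in> Arr Q. src Q f = X \<and> tgt Q f = Y}"

locale category =
  fixes Q :: "('o, 'm, 'x) category_scheme" (structure)
  assumes src_Obj: "f \<in> Arr Q \<Longrightarrow> src Q f \<in> Obj Q"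
    and tgt_Obj: "f \<in> Arr Q \<Longrightarrow> tgt Q f \<in> Obj Q"
    and ident_hom: "X \<in> Obj Q \<Longrightarrow> \<one> X \<in> hom Q X X"
    and comp_hom: "\<lbrakk>f \<in> hom Q X Y; g \<in> hom Q Y Z\<rbrakk> \<Longrightarrow> g \<cdot> f \<in> hom Q X Z"
    and comp_ident_right: "f \<in> hom Q X Y \<Longrightarrow> f \<cdot> \<one> X = f"
    and comp_ident_left: "f \<in> hom Q X Y \<Longrightarrow> \<one> Y \<cdot> f = f"
    and comp_assoc: "\<lbrakk>f \<in> hom Q W X; g \<in> hom Q X Y; h \<in> hom Q Y Z\<rbrakk>
      \<Longrightarrow> (h \<cdot> g) \<cdot> f = h \<cdot> (g \<cdot> f)"

definition inverse_arrows :: "('o, 'm, 'x) category_scheme \<Rightarrow> 'm \<Rightarrow> 'm \<Rightarrow> bool" where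
  "inverse_arrows Q f g \<longleftrightarrow>
     f \<in> Arr Q \<and> g \<in> hom Q (tgt Q f) (src Q f) \<and>
     g \<cdot> f = \<one> (src Q f) \<and> f \<cdot> g = \<one> (tgt Q f)" for Q (structure)

definition iso :: "('o, 'm, 'x) category_scheme \<Rightarrow> 'm \<Rightarrow> bool" where
  "iso Q f \<longleftrightarrow> (\<exists>g. inverse_arrows Q f g)"

definition arr_inv :: "('o, 'm, 'x) category_scheme \<Rightarrow> 'm \<Rightarrow> 'm" where
  "arr_inv Q f = (THE g. inverse_arrows Q f g)"

record ('o, 'm) z2_category = "('o, 'm) category" +
  grade :: "'m \<Rightarrow> bit"

locale z2_category = category Q
  for Q :: "('o, 'm, 'x) z2_category_scheme" (structure) +
  assumes grade_ident: "X \<in> Obj Q \<Longrightarrow> grade Q (\<one> X) = 0"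
    and grade_comp: "\<lbrakk>f \<in> hom Q X Y; g \<in> hom Q Y Z\<rbrakk>
      \<Longrightarrow> grade Q (g \<cdot> f) = grade Q g + grade Q f"
    and iso_of_grade: "X \<in> Obj Q \<Longrightarrow> \<exists>f. iso Q f \<and> src Q f = X \<and> grade Q f = d"

definition ghom :: "('o, 'm, 'x) z2_category_scheme \<Rightarrow> bit \<Rightarrow> 'o \<Rightarrow> 'o \<Rightarrow> 'm set" where
  "ghom Q d X Y = {f \<in> hom Q X Y. grade Q f = d}"

record ('o, 'm) z2_monoidal_category = "('o, 'm) z2_category" +
  tensor_obj :: "'o \<Rightarrow> 'o \<Rightarrow> 'o" (infixr "\<odot>\<index>" 75)
  tensor :: "'m \<Rightarrow> 'm \<Rightarrow> 'm" (infixr "\<otimes>\<index>" 75)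
  unit :: "'o" ("\<I>\<index>")
  unit_star :: "'m"
  associator :: "'o \<Rightarrow> 'o \<Rightarrow> 'o \<Rightarrow> 'm" ("\<a>\<index>")
  symmetry :: "'o \<Rightarrow> 'o \<Rightarrow> 'm" ("\<c>\<index>")
  unitor :: "'o \<Rightarrow> 'm" ("\<l>\<index>")

text \<open>The right unitor \<open>X \<odot> I \<rightarrow> X\<close> is not part of the data.\<close>

definition right_unitor :: "('o, 'm, 'x) z2_monoidal_category_scheme \<Rightarrow> 'o \<Rightarrow> 'm" ("\<r>\<index>") where
  "right_unitor Q X = \<l> X \<cdot> \<c> X \<I>" for Q (structure)

text \<open>
  The tensor \<open>f \<otimes> g\<close> is only meaningful for \<open>f\<close> and \<open>g\<close> of equal grade. Hence the functor
  \<open>I \<otimes> -\<close>, from which the unitor goes to the identity functor, sends an even \<open>f\<close> to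
  \<open>\<one> I \<otimes> f\<close> and an odd \<open>f\<close> to \<open>unit_star \<otimes> f\<close>; naturality of the unitor has one clause for
  each grade.
\<close>

locale z2_monoidal_category = z2_category Q
  for Q :: "('o, 'm, 'x) z2_monoidal_category_scheme" (structure) +
  assumes tensor_obj_Obj: "\<lbrakk>X \<in> Obj Q; Y \<in> Obj Q\<rbrakk> \<Longrightarrow> X \<odot> Y \<in> Obj Q"
    and tensor_ghom: "\<lbrakk>f \<in> ghom Q d X Y; f' \<in> ghom Q d X' Y'\<rbrakk>
      \<Longrightarrow> f \<otimes> f' \<in> ghom Q d (X \<odot> X') (Y \<odot> Y')"
    and tensor_ident: "\<lbrakk>X \<in> Obj Q; Y \<in> Obj Q\<rbrakk> \<Longrightarrow> \<one> X \<otimes> \<one> Y = \<one> (X \<odot> Y)"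
    and tensor_comp: "\<lbrakk>f \<in> ghom Q d X Y; f' \<in> ghom Q d X' Y';
        g \<in> ghom Q e Y Z; g' \<in> ghom Q e Y' Z'\<rbrakk>
      \<Longrightarrow> (g \<otimes> g') \<cdot> (f \<otimes> f') = (g \<cdot> f) \<otimes> (g' \<cdot> f')"
    and unit_Obj: "\<I> \<in> Obj Q"
    and unit_star_ghom: "unit_star Q \<in> ghom Q 1 \<I> \<I>"
    and unit_star_involution: "unit_star Q \<cdot> unit_star Q = \<one> \<I>"
    and associator_ghom: "\<lbrakk>X \<in> Obj Q; Y \<in> Obj Q; Z \<in> Obj Q\<rbrakk>
      \<Longrightarrow> \<a> X Y Z \<in> ghom Q 0 ((X \<odot> Y) \<odot> Z) (X \<odot> (Y \<odot> Z))"
    and associator_iso: "\<lbrakk>X \<in> Obj Q; Y \<in> Obj Q; Z \<in> Obj Q\<rbrakk> \<Longrightarrow> iso Q (\<a> X Y Z)"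
    and associator_natural: "\<lbrakk>f \<in> ghom Q d X X'; g \<in> ghom Q d Y Y'; h \<in> ghom Q d Z Z'\<rbrakk>
      \<Longrightarrow> \<a> X' Y' Z' \<cdot> ((f \<otimes> g) \<otimes> h) = (f \<otimes> (g \<otimes> h)) \<cdot> \<a> X Y Z"
    and symmetry_ghom: "\<lbrakk>X \<in> Obj Q; Y \<in> Obj Q\<rbrakk> \<Longrightarrow> \<c> X Y \<in> ghom Q 0 (X \<odot> Y) (Y \<odot> X)"
    and symmetry_natural: "\<lbrakk>f \<in> ghom Q d X X'; g \<in> ghom Q d Y Y'\<rbrakk>
      \<Longrightarrow> \<c> X' Y' \<cdot> (f \<otimes> g) = (g \<otimes> f) \<cdot> \<c> X Y"
    and unitor_ghom: "X \<in> Obj Q \<Longrightarrow> \<l> X \<in> ghom Q 0 (\<I> \<odot> X) X"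
    and unitor_iso: "X \<in> Obj Q \<Longrightarrow> iso Q (\<l> X)"
    and unitor_natural_even: "f \<in> ghom Q 0 X Y \<Longrightarrow> \<l> Y \<cdot> (\<one> \<I> \<otimes> f) = f \<cdot> \<l> X"
    and unitor_natural_odd: "f \<in> ghom Q 1 X Y \<Longrightarrow> \<l> Y \<cdot> (unit_star Q \<otimes> f) = f \<cdot> \<l> X"
    and pentagon: "\<lbrakk>W \<in> Obj Q; X \<in> Obj Q; Y \<in> Obj Q; Z \<in> Obj Q\<rbrakk>
      \<Longrightarrow> (\<one> W \<otimes> \<a> X Y Z) \<cdot> \<a> W (X \<odot> Y) Z \<cdot> (\<a> W X Y \<otimes> \<one> Z)
          = \<a> W X (Y \<odot> Z) \<cdot> \<a> (W \<odot> X) Y Z"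
    and triangle: "\<lbrakk>X \<in> Obj Q; Y \<in> Obj Q\<rbrakk>
      \<Longrightarrow> (\<one> X \<otimes> \<l> Y) \<cdot> \<a> X \<I> Y = \<r> X \<otimes> \<one> Y"
    and hexagon: "\<lbrakk>X \<in> Obj Q; Y \<in> Obj Q; Z \<in> Obj Q\<rbrakk>
      \<Longrightarrow> \<a> Y Z X \<cdot> \<c> X (Y \<odot> Z) \<cdot> \<a> X Y Z
          = (\<one> Y \<otimes> \<c> X Z) \<cdot> \<a> Y X Z \<cdot> (\<c> X Y \<otimes> \<one> Z)"
    and symmetry_inverse: "\<lbrakk>X \<in> Obj Q; Y \<in> Obj Q\<rbrakk> \<Longrightarrow> \<c> Y X \<cdot> \<c> X Y = \<one> (X \<odot> Y)"

text \<open>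
  The canonical map \<open>(X \<odot> X') \<odot> (Y \<odot> Y') \<rightarrow> (X \<odot> Y) \<odot> (X' \<odot> Y')\<close> that exchanges the two
  middle factors, that is \<open>id \<otimes> \<c> X' Y \<otimes> id\<close> up to associators.
\<close>

definition middle_swap :: "('o, 'm, 'x) z2_monoidal_category_scheme \<Rightarrow> 'o \<Rightarrow> 'o \<Rightarrow> 'o \<Rightarrow> 'o \<Rightarrow> 'm" where
  "middle_swap Q X X' Y Y' =
     arr_inv Q (\<a> X Y (X' \<odot> Y')) \<cdot>
     (\<one> X \<otimes> (\<a> Y X' Y' \<cdot> (\<c> X' Y \<otimes> \<one> Y') \<cdot> arr_inv Q (\<a> X' Y Y'))) \<cdot>
     \<a> X X' (Y \<odot> Y')" for Q (structure)


section \<open>Quantum CD and quantum Markov categories\<close>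

record ('o, 'm) quantum_CD_category = "('o, 'm) z2_monoidal_category" +
  copy :: "'o \<Rightarrow> 'm" ("\<Delta>\<index>")
  discard :: "'o \<Rightarrow> 'm" ("\<epsilon>\<index>")
  star :: "'o \<Rightarrow> 'm" ("\<star>\<index>")

text \<open>
  In \<open>discard_star\<close>, the case \<open>X = I\<close> together with \<open>discard_unit\<close> forces \<open>star Q I = unit_star Q\<close>.
  Axiom \<open>copy_unit\<close> says that \<open>\<Delta> I\<close> is the identity up to the canonical isomorphism \<open>\<l> I\<close>.
\<close>

locale quantum_CD_category = z2_monoidal_category Q
  for Q :: "('o, 'm, 'x) quantum_CD_category_scheme" (structure) +
  assumes copy_ghom: "X \<in> Obj Q \<Longrightarrow> \<Delta> X \<in> ghom Q 0 X (X \<odot> X)"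
    and discard_ghom: "X \<in> Obj Q \<Longrightarrow> \<epsilon> X \<in> ghom Q 0 X \<I>"
    and star_ghom: "X \<in> Obj Q \<Longrightarrow> \<star> X \<in> ghom Q 1 X X"
    and counit_left: "X \<in> Obj Q \<Longrightarrow> \<l> X \<cdot> (\<epsilon> X \<otimes> \<one> X) \<cdot> \<Delta> X = \<one> X"
    and counit_right: "X \<in> Obj Q \<Longrightarrow> \<r> X \<cdot> (\<one> X \<otimes> \<epsilon> X) \<cdot> \<Delta> X = \<one> X"
    and coassociative: "X \<in> Obj Q
      \<Longrightarrow> \<a> X X X \<cdot> (\<Delta> X \<otimes> \<one> X) \<cdot> \<Delta> X = (\<one> X \<otimes> \<Delta> X) \<cdot> \<Delta> X"
    and copy_star: "X \<in> Obj Q \<Longrightarrow> \<c> X X \<cdot> (\<star> X \<otimes> \<star> X) \<cdot> \<Delta> X = \<Delta> X \<cdot> \<star> X"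
    and discard_tensor: "\<lbrakk>X \<in> Obj Q; Y \<in> Obj Q\<rbrakk> \<Longrightarrow> \<epsilon> (X \<odot> Y) = \<l> \<I> \<cdot> (\<epsilon> X \<otimes> \<epsilon> Y)"
    and discard_unit: "\<epsilon> \<I> = \<one> \<I>"
    and copy_tensor: "\<lbrakk>X \<in> Obj Q; Y \<in> Obj Q\<rbrakk>
      \<Longrightarrow> \<Delta> (X \<odot> Y) = middle_swap Q X X Y Y \<cdot> (\<Delta> X \<otimes> \<Delta> Y)"
    and copy_unit: "\<l> \<I> \<cdot> \<Delta> \<I> = \<one> \<I>"
    and star_involution: "X \<in> Obj Q \<Longrightarrow> \<star> X \<cdot> \<star> X = \<one> X"
    and star_tensor: "\<lbrakk>X \<in> Obj Q; Y \<in> Obj Q\<rbrakk> \<Longrightarrow> \<star> (X \<odot> Y) = \<star> X \<otimes> \<star> Y"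
    and discard_star: "X \<in> Obj Q \<Longrightarrow> \<epsilon> X \<cdot> \<star> X = unit_star Q \<cdot> \<epsilon> X"

locale quantum_Markov_category = quantum_CD_category Q
  for Q :: "('o, 'm, 'x) quantum_CD_category_scheme" (structure) +
  assumes discard_even: "f \<in> ghom Q 0 X Y \<Longrightarrow> \<epsilon> Y \<cdot> f = \<epsilon> X"
    and discard_odd: "f \<in> ghom Q 1 X Y \<Longrightarrow> \<epsilon> Y \<cdot> f = \<epsilon> X \<cdot> \<star> X"


section \<open>Properties of morphisms\<close>

definition star_preserving :: "('o, 'm, 'x) quantum_CD_category_scheme \<Rightarrow> 'm \<Rightarrow> bool" where
  "star_preserving Q f \<longleftrightarrow> f \<in> Arr Q \<and> f \<cdot> \<star> (src Q f) = \<star> (tgt Q f) \<cdot> f" for Q (structure)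

definition even_morphism :: "('o, 'm, 'x) z2_category_scheme \<Rightarrow> 'm \<Rightarrow> bool" where
  "even_morphism Q f \<longleftrightarrow> f \<in> Arr Q \<and> grade Q f = 0"

definition deterministic :: "('o, 'm, 'x) quantum_CD_category_scheme \<Rightarrow> 'm \<Rightarrow> bool" where
  "deterministic Q f \<longleftrightarrow>
     even_morphism Q f \<and> star_preserving Q f \<and>
     \<Delta> (tgt Q f) \<cdot> f = (f \<otimes> f) \<cdot> \<Delta> (src Q f)" for Q (structure)

text \<open>
  In the conditions below, triple tensors are bracketed to the left in the left versions and
  to the right in the right versions, so that they involve no associators.
\<close>

definition left_ae_equivalent ::
  "('o, 'm, 'x) quantum_CD_category_scheme \<Rightarrow> 'm \<Rightarrow> 'm \<Rightarrow> 'm \<Rightarrow> bool" where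
  "left_ae_equivalent Q p f g \<longleftrightarrow>
     (\<exists>\<Theta> X Y. p \<in> hom Q \<Theta> X \<and> f \<in> ghom Q 0 X Y \<and> g \<in> ghom Q 0 X Y \<and>
        (f \<otimes> \<one> X) \<cdot> \<Delta> X \<cdot> p = (g \<otimes> \<one> X) \<cdot> \<Delta> X \<cdot> p)" for Q (structure)

definition right_ae_equivalent ::
  "('o, 'm, 'x) quantum_CD_category_scheme \<Rightarrow> 'm \<Rightarrow> 'm \<Rightarrow> 'm \<Rightarrow> bool" where
  "right_ae_equivalent Q p f g \<longleftrightarrow>
     (\<exists>\<Theta> X Y. p \<in> hom Q \<Theta> X \<and> f \<in> ghom Q 0 X Y \<and> g \<in> ghom Q 0 X Y \<and>
        (\<one> X \<otimes> f) \<cdot> \<Delta> X \<cdot> p = (\<one> X \<otimes> g) \<cdot> \<Delta> X \<cdot> p)" for Q (structure)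

definition left_ae_deterministic ::
  "('o, 'm, 'x) quantum_CD_category_scheme \<Rightarrow> 'm \<Rightarrow> 'm \<Rightarrow> bool" where
  "left_ae_deterministic Q p f \<longleftrightarrow>
     (\<exists>\<Theta> X Y. p \<in> hom Q \<Theta> X \<and> f \<in> ghom Q 0 X Y \<and>
        ((f \<otimes> f) \<otimes> \<one> X) \<cdot> (\<Delta> X \<otimes> \<one> X) \<cdot> \<Delta> X \<cdot> p
        = ((\<Delta> Y \<cdot> f) \<otimes> \<one> X) \<cdot> \<Delta> X \<cdot> p)" for Q (structure)

definition right_ae_deterministic ::
  "('o, 'm, 'x) quantum_CD_category_scheme \<Rightarrow> 'm \<Rightarrow> 'm \<Rightarrow> bool" where
  "right_ae_deterministic Q p f \<longleftrightarrow>
     (\<exists>\<Theta> X Y. p \<in> hom Q \<Theta> X \<and> f \<in> ghom Q 0 X Y \<and>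
        (\<one> X \<otimes> (f \<otimes> f)) \<cdot> (\<one> X \<otimes> \<Delta> X) \<cdot> \<Delta> X \<cdot> p
        = (\<one> X \<otimes> (\<Delta> Y \<cdot> f)) \<cdot> \<Delta> X \<cdot> p)" for Q (structure)


section \<open>Properties of subcategories\<close>

text \<open>A subcategory need be neither full nor wide, nor closed under the tensor product.\<close>

locale subcategory = category Q
  for Q :: "('o, 'm, 'x) category_scheme" (structure) +
  fixes CObj :: "'o set" and CArr :: "'m set"
  assumes CObj_subset: "CObj \<subseteq> Obj Q"
    and CArr_subset: "CArr \<subseteq> Arr Q"
    and src_CObj: "f \<in> CArr \<Longrightarrow> src Q f \<in> CObj"
    and tgt_CObj: "f \<in> CArr \<Longrightarrow> tgt Q f \<in> CObj"
    and ident_CArr: "X \<in> CObj \<Longrightarrow> \<one> X \<in> CArr"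
    and comp_CArr: "\<lbrakk>f \<in> CArr; g \<in> CArr; tgt Q f = src Q g\<rbrakk> \<Longrightarrow> g \<cdot> f \<in> CArr"

text \<open>
  The following properties of a subcategory depend only on its set \<open>C\<close> of morphisms.
\<close>

definition even_subcategory :: "('o, 'm, 'x) z2_category_scheme \<Rightarrow> 'm set \<Rightarrow> bool" where
  "even_subcategory Q C \<longleftrightarrow> (\<forall>f \<in> C. even_morphism Q f)"

definition star_preserving_subcategory ::
  "('o, 'm, 'x) quantum_CD_category_scheme \<Rightarrow> 'm set \<Rightarrow> bool" where
  "star_preserving_subcategory Q C \<longleftrightarrow> (\<forall>f \<in> C. star_preserving Q f)"

text \<open>The deterministic morphism \<open>g\<close> is not required to lie in the subcategory.\<close>

definition deterministically_reasonable ::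
  "('o, 'm, 'x) quantum_CD_category_scheme \<Rightarrow> 'm set \<Rightarrow> bool" where
  "deterministically_reasonable Q C \<longleftrightarrow>
     (\<forall>f \<in> C. \<forall>p \<in> C.
        ((\<exists>g. deterministic Q g \<and> right_ae_equivalent Q p f g) \<longrightarrow> right_ae_deterministic Q p f) \<and>
        ((\<exists>g. deterministic Q g \<and> left_ae_equivalent Q p f g) \<longrightarrow> left_ae_deterministic Q p f))"

text \<open>
  Strict positivity and a.e. modularity come in a left and a right version. For an even,
  star-preserving subcategory of a quantum Markov category the two versions are equivalent, since
  \<open>copy_star\<close> interchanges them, and the adjective is customarily dropped.
\<close>

definition left_strictly_positive ::
  "('o, 'm, 'x) quantum_CD_category_scheme \<Rightarrow> 'm set \<Rightarrow> bool" where
  "left_strictly_positive Q C \<longleftrightarrow>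
     (\<forall>\<Theta> X Y Z. \<forall>q \<in> C \<inter> hom Q \<Theta> Y. \<forall>g \<in> C \<inter> hom Q Y X. \<forall>f \<in> C \<inter> hom Q X Z.
        left_ae_deterministic Q q (f \<cdot> g) \<longrightarrow>
        ((\<one> X \<otimes> f) \<otimes> \<one> Y) \<cdot> ((\<Delta> X \<cdot> g) \<otimes> \<one> Y) \<cdot> \<Delta> Y \<cdot> q
        = ((g \<otimes> (f \<cdot> g)) \<otimes> \<one> Y) \<cdot> (\<Delta> Y \<otimes> \<one> Y) \<cdot> \<Delta> Y \<cdot> q)" for Q (structure)

definition right_strictly_positive ::
  "('o, 'm, 'x) quantum_CD_category_scheme \<Rightarrow> 'm set \<Rightarrow> bool" where
  "right_strictly_positive Q C \<longleftrightarrow>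
     (\<forall>\<Theta> X Y Z. \<forall>q \<in> C \<inter> hom Q \<Theta> Y. \<forall>g \<in> C \<inter> hom Q Y X. \<forall>f \<in> C \<inter> hom Q X Z.
        right_ae_deterministic Q q (f \<cdot> g) \<longrightarrow>
        (\<one> Y \<otimes> (f \<otimes> \<one> X)) \<cdot> (\<one> Y \<otimes> (\<Delta> X \<cdot> g)) \<cdot> \<Delta> Y \<cdot> q
        = (\<one> Y \<otimes> ((f \<cdot> g) \<otimes> g)) \<cdot> (\<one> Y \<otimes> \<Delta> Y) \<cdot> \<Delta> Y \<cdot> q)" for Q (structure)

definition left_ae_modular ::
  "('o, 'm, 'x) quantum_CD_category_scheme \<Rightarrow> 'm set \<Rightarrow> bool" where
  "left_ae_modular Q C \<longleftrightarrow>
     (\<forall>\<Theta> X Y. \<forall>f \<in> C \<inter> hom Q X Y. \<forall>g \<in> C \<inter> hom Q Y X. \<forall>q \<in> C \<inter> hom Q \<Theta> Y.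
        left_ae_equivalent Q q (f \<cdot> g) (\<one> Y) \<longrightarrow>
        ((\<one> X \<otimes> f) \<otimes> \<one> Y) \<cdot> ((\<Delta> X \<cdot> g) \<otimes> \<one> Y) \<cdot> \<Delta> Y \<cdot> q
        = ((g \<otimes> \<one> Y) \<otimes> \<one> Y) \<cdot> (\<Delta> Y \<otimes> \<one> Y) \<cdot> \<Delta> Y \<cdot> q)" for Q (structure)

definition right_ae_modular ::
  "('o, 'm, 'x) quantum_CD_category_scheme \<Rightarrow> 'm set \<Rightarrow> bool" where
  "right_ae_modular Q C \<longleftrightarrow>
     (\<forall>\<Theta> X Y. \<forall>f \<in> C \<inter> hom Q X Y. \<forall>g \<in> C \<inter> hom Q Y X. \<forall>q \<in> C \<inter> hom Q \<Theta> Y.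
        right_ae_equivalent Q q (f \<cdot> g) (\<one> Y) \<longrightarrow>
        (\<one> Y \<otimes> (f \<otimes> \<one> X)) \<cdot> (\<one> Y \<otimes> (\<Delta> X \<cdot> g)) \<cdot> \<Delta> Y \<cdot> q
        = (\<one> Y \<otimes> (\<one> Y \<otimes> g)) \<cdot> (\<one> Y \<otimes> \<Delta> Y) \<cdot> \<Delta> Y \<cdot> q)" for Q (structure)

definition S_positive ::
  "('o, 'm, 'x) quantum_CD_category_scheme \<Rightarrow> 'm set \<Rightarrow> bool" where
  "S_positive Q C \<longleftrightarrow>
     (\<forall>X Y Z. \<forall>f \<in> C \<inter> hom Q X Y. \<forall>g \<in> C \<inter> hom Q Y Z.
        deterministic Q (g \<cdot> f) \<longrightarrow>
        (g \<otimes> \<one> Y) \<cdot> \<Delta> Y \<cdot> f = ((g \<cdot> f) \<otimes> f) \<cdot> \<Delta> X)" for Q (structure)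

end

theory Submission
  imports Defs
begin

text \<open>
  Applying the star to every factor and reversing the tensor order exchanges the left and right
  versions of an equation between star-preserving morphisms, because \<open>copy_star\<close> turns the
  resulting swaps into a star on the domain. So it suffices to treat one side of each claim.

  If \<open>h = f \<cdot> g\<close> is \<open>q\<close>-a.e. the identity, it is \<open>q\<close>-a.e. deterministic, and strict positivity
  gives modularity once \<open>h\<close> can be dropped from the middle of the three copies of \<open>q\<close>. Almost
  everywhere equality only gives this at an outer leg; but inserting \<open>h\<close> at the left leg as well
  makes the pair into \<open>\<Delta> \<cdot> h\<close> by determinism, and then \<open>h\<close> sits at an outer leg again.

  S-positivity is right strict positivity at \<open>q = id\<close> with the leftmost leg discarded.
\<close>

section \<open>Typing and cancellation for composition\<close>

context category
begin

text \<open>Typing is phrased through the functions \<open>src\<close> and \<open>tgt\<close> rather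
  than membership in \<open>hom\<close> sets, which makes it purely equational.\<close>

lemma comp_typing [simp]:
  assumes "f \<in> Arr Q" "g \<in> Arr Q" "tgt Q f = src Q g"
  shows "g \<cdot> f \<in> Arr Q" "src Q (g \<cdot> f) = src Q f" "tgt Q (g \<cdot> f) = tgt Q g"
  using comp_hom[of f "src Q f" "src Q g" g "tgt Q g"] assms by (auto simp: hom_def)

lemma ident_typing [simp]:
  assumes "X \<in> Obj Q"
  shows "\<one> X \<in> Arr Q" "src Q (\<one> X) = X" "tgt Q (\<one> X) = X"
  using ident_hom[OF assms] by (auto simp: hom_def)

lemma src_tgt_Obj [simp]: "f \<in> Arr Q \<Longrightarrow> src Q f \<in> Obj Q" "f \<in> Arr Q \<Longrightarrow> tgt Q f \<in> Obj Q"
  by (fact src_Obj tgt_Obj)+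

lemma comp_ident [simp]:
  assumes "f \<in> Arr Q"
  shows "src Q f = X \<Longrightarrow> f \<cdot> \<one> X = f" "tgt Q f = X \<Longrightarrow> \<one> X \<cdot> f = f"
  using assms comp_ident_left comp_ident_right by (auto simp: hom_def)

lemma comp_assoc_Arr:
  assumes "f \<in> Arr Q" "g \<in> Arr Q" "h \<in> Arr Q" "tgt Q f = src Q g" "tgt Q g = src Q h"
  shows "(h \<cdot> g) \<cdot> f = h \<cdot> (g \<cdot> f)"
  using assms comp_assoc[of f "src Q f" "src Q g" g "src Q h" h "tgt Q h"] by (auto simp: hom_def)

lemma iso_cancel_left:
  assumes "iso Q i" "i \<cdot> f = i \<cdot> g" "f \<in> Arr Q" "g \<in> Arr Q" "tgt Q f = src Q i" "tgt Q g = src Q i"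
  shows "f = g"
proof -
  obtain j where j: "i \<in> Arr Q" "j \<in> Arr Q" "src Q j = tgt Q i" "tgt Q j = src Q i" "j \<cdot> i = \<one> (src Q i)"
    using assms(1) by (auto simp: iso_def inverse_arrows_def hom_def)
  have "(j \<cdot> i) \<cdot> f = j \<cdot> (i \<cdot> f)" "(j \<cdot> i) \<cdot> g = j \<cdot> (i \<cdot> g)"
    using assms j(1-4) by (simp_all add: comp_assoc_Arr)
  then have "\<one> (src Q i) \<cdot> f = \<one> (src Q i) \<cdot> g"
    using assms(2) j(5) by simp
  then show ?thesis using assms by simp
qed

end

context z2_category
begin

lemma grade_comp_Arr [simp]:
  assumes "f \<in> Arr Q" "g \<in> Arr Q" "tgt Q f = src Q g"
  shows "grade Q (g \<cdot> f) = grade Q g + grade Q f"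
  using grade_comp[of f "src Q f" "src Q g" g "tgt Q g"] assms by (auto simp: hom_def)

lemmas grade_ident [simp]

end

section \<open>Interchange law and symmetry for the graded tensor product\<close>

context z2_monoidal_category
begin

lemma tensor_typing [simp]:
  assumes "f \<in> Arr Q" "g \<in> Arr Q" "grade Q f = grade Q g"
  shows "f \<otimes> g \<in> Arr Q" "src Q (f \<otimes> g) = src Q f \<odot> src Q g"
    "tgt Q (f \<otimes> g) = tgt Q f \<odot> tgt Q g" "grade Q (f \<otimes> g) = grade Q f"
  using tensor_ghom[of f "grade Q f" "src Q f" "tgt Q f" g "src Q g" "tgt Q g"] assms
  by (auto simp: hom_def ghom_def)

lemmas tensor_obj_Obj [simp] unit_Obj [simp] tensor_ident [simp]

lemma symmetry_typing [simp]:
  assumes "X \<in> Obj Q" "Y \<in> Obj Q"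
  shows "\<c> X Y \<in> Arr Q" "src Q (\<c> X Y) = X \<odot> Y" "tgt Q (\<c> X Y) = Y \<odot> X" "grade Q (\<c> X Y) = 0"
  using symmetry_ghom[OF assms] by (auto simp: hom_def ghom_def)

lemma associator_typing [simp]:
  assumes "X \<in> Obj Q" "Y \<in> Obj Q" "Z \<in> Obj Q"
  shows "\<a> X Y Z \<in> Arr Q" "src Q (\<a> X Y Z) = (X \<odot> Y) \<odot> Z" "tgt Q (\<a> X Y Z) = X \<odot> (Y \<odot> Z)"
    "grade Q (\<a> X Y Z) = 0"
  using associator_ghom[OF assms] by (auto simp: hom_def ghom_def)

lemma unitor_typing [simp]:
  assumes "X \<in> Obj Q"
  shows "\<l> X \<in> Arr Q" "src Q (\<l> X) = \<I> \<odot> X" "tgt Q (\<l> X) = X" "grade Q (\<l> X) = 0"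
  using unitor_ghom[OF assms] by (auto simp: hom_def ghom_def)

lemma tensor_comp_Arr:
  assumes "f \<in> Arr Q" "f' \<in> Arr Q" "g \<in> Arr Q" "g' \<in> Arr Q"
    and "tgt Q f = src Q g" "tgt Q f' = src Q g'" "grade Q f = grade Q f'" "grade Q g = grade Q g'"
  shows "(g \<otimes> g') \<cdot> (f \<otimes> f') = (g \<cdot> f) \<otimes> (g' \<cdot> f')"
  using assms tensor_comp[of f "grade Q f" "src Q f" "src Q g" f' "src Q f'" "src Q g'"
      g "grade Q g" "tgt Q g" g' "tgt Q g'"]
  by (auto simp: hom_def ghom_def)

text \<open>The trailing factor \<open>k\<close> makes interchange applicable inside a composite
  nested to the right. The \<open>_assoc\<close> rules for the symmetry serve the same
  purpose.\<close>

lemma tensor_comp_Arr_assoc: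
  assumes "f \<in> Arr Q" "f' \<in> Arr Q" "g \<in> Arr Q" "g' \<in> Arr Q" "k \<in> Arr Q"
    and "tgt Q f = src Q g" "tgt Q f' = src Q g'" "grade Q f = grade Q f'" "grade Q g = grade Q g'"
    and "tgt Q k = src Q f \<odot> src Q f'"
  shows "(g \<otimes> g') \<cdot> ((f \<otimes> f') \<cdot> k) = ((g \<cdot> f) \<otimes> (g' \<cdot> f')) \<cdot> k"
  using assms by (simp add: comp_assoc_Arr[symmetric] tensor_comp_Arr)

lemma symmetry_natural_Arr:
  assumes "f \<in> Arr Q" "g \<in> Arr Q" "grade Q f = grade Q g" "tgt Q f = X" "tgt Q g = Y"
  shows "\<c> X Y \<cdot> (f \<otimes> g) = (g \<otimes> f) \<cdot> \<c> (src Q f) (src Q g)"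
  using assms symmetry_natural[of f "grade Q f" "src Q f" X g "src Q g" Y]
  by (auto simp: hom_def ghom_def)

lemma symmetry_natural_assoc:
  assumes "f \<in> Arr Q" "g \<in> Arr Q" "k \<in> Arr Q" "grade Q f = grade Q g" "tgt Q f = X" "tgt Q g = Y"
    and "tgt Q k = src Q f \<odot> src Q g"
  shows "\<c> X Y \<cdot> ((f \<otimes> g) \<cdot> k) = (g \<otimes> f) \<cdot> (\<c> (src Q f) (src Q g) \<cdot> k)"
proof -
  have "X \<in> Obj Q" "Y \<in> Obj Q" using assms by auto
  then have "\<c> X Y \<cdot> ((f \<otimes> g) \<cdot> k) = (\<c> X Y \<cdot> (f \<otimes> g)) \<cdot> k"
    using assms by (intro comp_assoc_Arr[symmetric]) simp_all
  also have "\<dots> = ((g \<otimes> f) \<cdot> \<c> (src Q f) (src Q g)) \<cdot> k"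
    using assms(1-6) by (simp add: symmetry_natural_Arr)
  also have "\<dots> = (g \<otimes> f) \<cdot> (\<c> (src Q f) (src Q g) \<cdot> k)"
    using assms by (intro comp_assoc_Arr) simp_all
  finally show ?thesis .
qed

lemma symmetry_inverse_assoc:
  assumes "X \<in> Obj Q" "Y \<in> Obj Q" "k \<in> Arr Q" "tgt Q k = X \<odot> Y"
  shows "\<c> Y X \<cdot> (\<c> X Y \<cdot> k) = k"
  using assms by (simp add: comp_assoc_Arr[symmetric] symmetry_inverse)

end

section \<open>Even star-preserving morphisms and reversal of the tensor order\<close>

context quantum_CD_category
begin

lemma copy_discard_star_typing [simp]:
  assumes "X \<in> Obj Q"
  shows "\<Delta> X \<in> Arr Q" "src Q (\<Delta> X) = X" "tgt Q (\<Delta> X) = X \<odot> X" "grade Q (\<Delta> X) = 0"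
    "\<epsilon> X \<in> Arr Q" "src Q (\<epsilon> X) = X" "tgt Q (\<epsilon> X) = \<I>" "grade Q (\<epsilon> X) = 0"
    "\<star> X \<in> Arr Q" "src Q (\<star> X) = X" "tgt Q (\<star> X) = X" "grade Q (\<star> X) = 1"
  using copy_ghom[OF assms] discard_ghom[OF assms] star_ghom[OF assms]
  by (auto simp: hom_def ghom_def)

lemmas star_involution [simp]

text \<open>Every arrow of the subcategory in the theorem lies in such a set. Evenness makes these
  arrows tensorable with each other and with identities; star preservation lets stars pass through
  them.\<close>

definition star_hom :: "'o \<Rightarrow> 'o \<Rightarrow> 'm set" where
  "star_hom X Y = {f \<in> ghom Q 0 X Y. star_preserving Q f}"

lemma star_hom_iff:
  "f \<in> star_hom X Y \<longleftrightarrow>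
     f \<in> Arr Q \<and> src Q f = X \<and> tgt Q f = Y \<and> grade Q f = 0 \<and> f \<cdot> \<star> X = \<star> Y \<cdot> f"
  by (auto simp: star_hom_def ghom_def hom_def star_preserving_def)

lemma star_homD:
  assumes "f \<in> star_hom X Y"
  shows "f \<in> Arr Q" "src Q f = X" "tgt Q f = Y" "grade Q f = 0" "f \<cdot> \<star> X = \<star> Y \<cdot> f"
    "X \<in> Obj Q" "Y \<in> Obj Q"
  using assms src_Obj tgt_Obj by (auto simp: star_hom_iff)

lemma star_hom_ident: "X \<in> Obj Q \<Longrightarrow> \<one> X \<in> star_hom X X"
  by (simp add: star_hom_iff)

lemma star_hom_comp:
  assumes "f \<in> star_hom X Y" "g \<in> star_hom Y Z"
  shows "g \<cdot> f \<in> star_hom X Z"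
proof -
  note [simp] = star_homD[OF assms(1)] star_homD[OF assms(2)]
  have "(g \<cdot> f) \<cdot> \<star> X = (g \<cdot> \<star> Y) \<cdot> f"
    by (simp add: comp_assoc_Arr del: star_homD(5)[OF assms(2)])
  also have "\<dots> = \<star> Z \<cdot> (g \<cdot> f)"
    by (simp add: comp_assoc_Arr)
  finally show ?thesis by (simp add: star_hom_iff)
qed

lemma deterministic_ident: "X \<in> Obj Q \<Longrightarrow> deterministic Q (\<one> X)"
  by (simp add: deterministic_def even_morphism_def star_preserving_def)

text \<open>The odd map that stars all three factors and reverses their order. It leads from left to
  right bracketing, the formats of the left and right conditions, and therefore involves no
  associator.\<close>

definition mirror :: "'o \<Rightarrow> 'o \<Rightarrow> 'o \<Rightarrow> 'm" where
  "mirror X Y Z = (\<one> Z \<otimes> \<c> X Y) \<cdot> (\<c> (X \<odot> Y) Z \<cdot> ((\<star> X \<otimes> \<star> Y) \<otimes> \<star> Z))"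

lemma mirror_typing [simp]:
  assumes "X \<in> Obj Q" "Y \<in> Obj Q" "Z \<in> Obj Q"
  shows "mirror X Y Z \<in> Arr Q" "src Q (mirror X Y Z) = (X \<odot> Y) \<odot> Z"
    "tgt Q (mirror X Y Z) = Z \<odot> (Y \<odot> X)" "grade Q (mirror X Y Z) = 1"
  using assms by (simp_all add: mirror_def)

lemma mirror_left_inverse:
  assumes [simp]: "X \<in> Obj Q" "Y \<in> Obj Q" "Z \<in> Obj Q"
  shows "(((\<star> X \<otimes> \<star> Y) \<otimes> \<star> Z) \<cdot> (\<c> Z (X \<odot> Y) \<cdot> (\<one> Z \<otimes> \<c> Y X))) \<cdot> mirror X Y Z
    = \<one> ((X \<odot> Y) \<odot> Z)"
  by (simp add: mirror_def comp_assoc_Arr tensor_comp_Arr_assoc tensor_comp_Arr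
      symmetry_inverse symmetry_inverse_assoc)

text \<open>\<open>mirror\<close> is split monic, so an equation between left-bracketed triples may
  be checked after reversal.\<close>

lemma mirror_cancel_left:
  assumes "mirror X Y Z \<cdot> f = mirror X Y Z \<cdot> g" "X \<in> Obj Q" "Y \<in> Obj Q" "Z \<in> Obj Q"
    and "f \<in> Arr Q" "g \<in> Arr Q" "tgt Q f = (X \<odot> Y) \<odot> Z" "tgt Q g = (X \<odot> Y) \<odot> Z"
  shows "f = g"
proof -
  let ?n = "((\<star> X \<otimes> \<star> Y) \<otimes> \<star> Z) \<cdot> (\<c> Z (X \<odot> Y) \<cdot> (\<one> Z \<otimes> \<c> Y X))"
  have "(?n \<cdot> mirror X Y Z) \<cdot> f = ?n \<cdot> (mirror X Y Z \<cdot> f)"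
    using assms(2-) by (intro comp_assoc_Arr) simp_all
  moreover have "(?n \<cdot> mirror X Y Z) \<cdot> g = ?n \<cdot> (mirror X Y Z \<cdot> g)"
    using assms(2-) by (intro comp_assoc_Arr) simp_all
  ultimately show ?thesis
    using assms by (simp add: mirror_left_inverse)
qed

lemma star_cancel_right:
  assumes "f \<cdot> \<star> X = g \<cdot> \<star> X" "f \<in> Arr Q" "g \<in> Arr Q" "src Q f = X" "src Q g = X"
  shows "f = g"
proof -
  have "(f \<cdot> \<star> X) \<cdot> \<star> X = (g \<cdot> \<star> X) \<cdot> \<star> X" using assms by simp
  moreover have "X \<in> Obj Q" using assms by auto
  ultimately show ?thesis using assms(2-) by (simp add: comp_assoc_Arr)
qed

text \<open>This is \<open>copy_star\<close> composed with \<open>\<c> X X\<close>, which is its own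
  inverse: stars on both outputs of a copy move to its input at the price of a swap.\<close>

lemma star_star_copy: "X \<in> Obj Q \<Longrightarrow> (\<star> X \<otimes> \<star> X) \<cdot> \<Delta> X = \<c> X X \<cdot> (\<Delta> X \<cdot> \<star> X)"
  by (simp add: copy_star[symmetric] comp_assoc_Arr symmetry_inverse_assoc)

lemma star_star_copy_comp:
  assumes "f \<in> star_hom X Y"
  shows "(\<star> Y \<otimes> \<star> Y) \<cdot> (\<Delta> Y \<cdot> f) = \<c> Y Y \<cdot> ((\<Delta> Y \<cdot> f) \<cdot> \<star> X)"
proof -
  note [simp] = star_homD[OF assms]
  have "(\<star> Y \<otimes> \<star> Y) \<cdot> (\<Delta> Y \<cdot> f) = ((\<star> Y \<otimes> \<star> Y) \<cdot> \<Delta> Y) \<cdot> f"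
    by (simp add: comp_assoc_Arr)
  then show ?thesis by (simp add: star_star_copy comp_assoc_Arr)
qed

text \<open>Star preservation carries \<open>u\<close>, \<open>v\<close>, \<open>w\<close> past the
  stars, and naturality of the symmetry carries them past the two swaps.\<close>

lemma mirror_natural:
  assumes "u \<in> star_hom X X'" "v \<in> star_hom Y Y'" "w \<in> star_hom Z Z'"
  shows "mirror X' Y' Z' \<cdot> ((u \<otimes> v) \<otimes> w) = (w \<otimes> (v \<otimes> u)) \<cdot> mirror X Y Z"
proof -
  note [simp] = star_homD[OF assms(1)] star_homD[OF assms(2)] star_homD[OF assms(3)]
  have "mirror X' Y' Z' \<cdot> ((u \<otimes> v) \<otimes> w)
    = (\<one> Z' \<otimes> \<c> X' Y') \<cdot> (\<c> (X' \<odot> Y') Z' \<cdot> (((\<star> X' \<cdot> u) \<otimes> (\<star> Y' \<cdot> v)) \<otimes> (\<star> Z' \<cdot> w)))"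
    by (simp add: mirror_def comp_assoc_Arr tensor_comp_Arr)
  also have "\<dots> = (\<one> Z' \<otimes> \<c> X' Y') \<cdot> (\<c> (X' \<odot> Y') Z' \<cdot>
      (((u \<otimes> v) \<otimes> w) \<cdot> ((\<star> X \<otimes> \<star> Y) \<otimes> \<star> Z)))"
    by (simp add: tensor_comp_Arr)
  also have "\<dots> = (w \<otimes> (v \<otimes> u)) \<cdot> mirror X Y Z"
    by (simp add: mirror_def symmetry_natural_assoc symmetry_natural_Arr tensor_comp_Arr_assoc)
  finally show ?thesis .
qed

text \<open>Moving the stars through the inner and then the outer copy creates one swap each. These
  cancel the two swaps in \<open>mirror\<close>, and only the star on \<open>T\<close>
  remains.\<close>

lemma mirror_copy:
  assumes "g \<in> star_hom Y X" "q \<in> star_hom T Y"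
  shows "mirror X X Y \<cdot> (((\<Delta> X \<cdot> g) \<otimes> \<one> Y) \<cdot> (\<Delta> Y \<cdot> q))
    = ((\<one> Y \<otimes> (\<Delta> X \<cdot> g)) \<cdot> (\<Delta> Y \<cdot> q)) \<cdot> \<star> T"
proof -
  note [simp] = star_homD[OF assms(1)] star_homD[OF assms(2)]
  have "mirror X X Y \<cdot> (((\<Delta> X \<cdot> g) \<otimes> \<one> Y) \<cdot> (\<Delta> Y \<cdot> q))
    = (\<one> Y \<otimes> \<c> X X) \<cdot> (\<c> (X \<odot> X) Y \<cdot> ((((\<star> X \<otimes> \<star> X) \<cdot> (\<Delta> X \<cdot> g)) \<otimes> \<star> Y) \<cdot> (\<Delta> Y \<cdot> q)))"
    by (simp add: mirror_def comp_assoc_Arr tensor_comp_Arr_assoc)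
  also have "\<dots> = (\<one> Y \<otimes> \<c> X X) \<cdot> (\<c> (X \<odot> X) Y \<cdot>
      (((\<c> X X \<cdot> (\<Delta> X \<cdot> g)) \<otimes> \<one> Y) \<cdot> ((\<star> Y \<otimes> \<star> Y) \<cdot> (\<Delta> Y \<cdot> q))))"
    by (simp add: star_star_copy_comp[OF assms(1)] tensor_comp_Arr_assoc comp_assoc_Arr)
  also have "\<dots> = ((\<one> Y \<otimes> (\<Delta> X \<cdot> g)) \<cdot> (\<Delta> Y \<cdot> q)) \<cdot> \<star> T"
    unfolding star_star_copy_comp[OF assms(2)]
    by (simp add: symmetry_natural_assoc tensor_comp_Arr_assoc symmetry_inverse_assoc comp_assoc_Arr)
  finally show ?thesis .
qed

text \<open>One equivalence general enough for a.e. determinism, strict positivity and a.e.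
  modularity: each compares two composites of this shape, with identities in the vacant places.
  Reversing either composite yields its mirror image followed on the domain by
  \<open>\<star> T\<close>; both \<open>mirror\<close> and \<open>\<star> T\<close> can be
  cancelled.\<close>

lemma mirror_eq_iff:
  assumes "u \<in> star_hom X A" "v \<in> star_hom X B" "g \<in> star_hom Y X"
    and "u' \<in> star_hom X' A" "v' \<in> star_hom X' B" "g' \<in> star_hom Y X'"
    and "q \<in> star_hom T Y"
  shows "((u \<otimes> v) \<otimes> \<one> Y) \<cdot> ((\<Delta> X \<cdot> g) \<otimes> \<one> Y) \<cdot> \<Delta> Y \<cdot> q
      = ((u' \<otimes> v') \<otimes> \<one> Y) \<cdot> ((\<Delta> X' \<cdot> g') \<otimes> \<one> Y) \<cdot> \<Delta> Y \<cdot> q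
    \<longleftrightarrow> (\<one> Y \<otimes> (v \<otimes> u)) \<cdot> (\<one> Y \<otimes> (\<Delta> X \<cdot> g)) \<cdot> \<Delta> Y \<cdot> q
      = (\<one> Y \<otimes> (v' \<otimes> u')) \<cdot> (\<one> Y \<otimes> (\<Delta> X' \<cdot> g')) \<cdot> \<Delta> Y \<cdot> q"
    (is "?L = ?L' \<longleftrightarrow> ?R = ?R'")
proof -
  \<comment> \<open>Here \<open>u\<close>, \<open>v\<close>, \<open>g\<close> and their middle
    object are generic, so that the computation covers both sides of the equation.\<close>
  have mirror: "mirror A B Y \<cdot> (((u \<otimes> v) \<otimes> \<one> Y) \<cdot> ((\<Delta> X \<cdot> g) \<otimes> \<one> Y) \<cdot> \<Delta> Y \<cdot> q)
      = ((\<one> Y \<otimes> (v \<otimes> u)) \<cdot> (\<one> Y \<otimes> (\<Delta> X \<cdot> g)) \<cdot> \<Delta> Y \<cdot> q) \<cdot> \<star> T"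
    if uvg: "u \<in> star_hom X A" "v \<in> star_hom X B" "g \<in> star_hom Y X" for u v g X
  proof -
    note [simp] = star_homD[OF uvg(1)] star_homD[OF uvg(2)] star_homD[OF uvg(3)] star_homD[OF assms(7)]
    have "mirror A B Y \<cdot> (((u \<otimes> v) \<otimes> \<one> Y) \<cdot> ((\<Delta> X \<cdot> g) \<otimes> \<one> Y) \<cdot> \<Delta> Y \<cdot> q)
      = (mirror A B Y \<cdot> ((u \<otimes> v) \<otimes> \<one> Y)) \<cdot> (((\<Delta> X \<cdot> g) \<otimes> \<one> Y) \<cdot> (\<Delta> Y \<cdot> q))"
      by (simp add: comp_assoc_Arr)
    also have "\<dots> = (\<one> Y \<otimes> (v \<otimes> u)) \<cdot> (mirror X X Y \<cdot> (((\<Delta> X \<cdot> g) \<otimes> \<one> Y) \<cdot> (\<Delta> Y \<cdot> q)))"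
      by (simp add: mirror_natural[OF uvg(1,2) star_hom_ident] comp_assoc_Arr)
    also have "\<dots> = ((\<one> Y \<otimes> (v \<otimes> u)) \<cdot> (\<one> Y \<otimes> (\<Delta> X \<cdot> g)) \<cdot> \<Delta> Y \<cdot> q) \<cdot> \<star> T"
      by (simp add: mirror_copy[OF uvg(3) assms(7)] comp_assoc_Arr)
    finally show ?thesis .
  qed
  note typing = assms[THEN star_homD(1)] assms[THEN star_homD(2)] assms[THEN star_homD(3)]
    assms[THEN star_homD(4)] assms[THEN star_homD(6)] assms[THEN star_homD(7)]
  note mm = mirror[OF assms(1-3)] mirror[OF assms(4-6)]
  show ?thesis
  proof
    assume "?L = ?L'"
    then have "?R \<cdot> \<star> T = ?R' \<cdot> \<star> T" using mm by simp
    then show "?R = ?R'" by (rule star_cancel_right) (simp_all add: typing)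
  next
    assume "?R = ?R'"
    then have "mirror A B Y \<cdot> ?L = mirror A B Y \<cdot> ?L'" using mm by simp
    then show "?L = ?L'" by (rule mirror_cancel_left) (simp_all add: typing)
  qed
qed

section \<open>Almost everywhere notions and their left-right symmetry\<close>

lemma left_ae_deterministic_iff:
  assumes "q \<in> star_hom T X" "f \<in> ghom Q 0 X Y"
  shows "left_ae_deterministic Q q f \<longleftrightarrow>
    ((f \<otimes> f) \<otimes> \<one> X) \<cdot> (\<Delta> X \<otimes> \<one> X) \<cdot> \<Delta> X \<cdot> q = ((\<Delta> Y \<cdot> f) \<otimes> \<one> X) \<cdot> \<Delta> X \<cdot> q"
  using assms by (auto simp: left_ae_deterministic_def star_hom_def ghom_def hom_def)

lemma right_ae_deterministic_iff:
  assumes "q \<in> star_hom T X" "f \<in> ghom Q 0 X Y"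
  shows "right_ae_deterministic Q q f \<longleftrightarrow>
    (\<one> X \<otimes> (f \<otimes> f)) \<cdot> (\<one> X \<otimes> \<Delta> X) \<cdot> \<Delta> X \<cdot> q = (\<one> X \<otimes> (\<Delta> Y \<cdot> f)) \<cdot> \<Delta> X \<cdot> q"
  using assms by (auto simp: right_ae_deterministic_def star_hom_def ghom_def hom_def)

lemma left_ae_equivalent_iff:
  assumes "q \<in> star_hom T X" "f \<in> ghom Q 0 X Y" "g \<in> ghom Q 0 X Y"
  shows "left_ae_equivalent Q q f g \<longleftrightarrow> (f \<otimes> \<one> X) \<cdot> \<Delta> X \<cdot> q = (g \<otimes> \<one> X) \<cdot> \<Delta> X \<cdot> q"
  using assms by (auto simp: left_ae_equivalent_def star_hom_def ghom_def hom_def)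

lemma right_ae_equivalent_iff:
  assumes "q \<in> star_hom T X" "f \<in> ghom Q 0 X Y" "g \<in> ghom Q 0 X Y"
  shows "right_ae_equivalent Q q f g \<longleftrightarrow> (\<one> X \<otimes> f) \<cdot> \<Delta> X \<cdot> q = (\<one> X \<otimes> g) \<cdot> \<Delta> X \<cdot> q"
  using assms by (auto simp: right_ae_equivalent_def star_hom_def ghom_def hom_def)

lemma star_hom_ghom: "f \<in> star_hom X Y \<Longrightarrow> f \<in> ghom Q 0 X Y"
  by (simp add: star_hom_def)

lemma ae_deterministic_left_iff_right:
  assumes "q \<in> star_hom T X" "f \<in> star_hom X Y"
  shows "left_ae_deterministic Q q f \<longleftrightarrow> right_ae_deterministic Q q f"
proof -
  note [simp] = star_homD(1-4,6,7)[OF assms(1)] star_homD(1-4,6,7)[OF assms(2)]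
  show ?thesis
    \<comment> \<open>On one side \<open>u = v = f\<close> after copying \<open>X\<close>; on the
      other \<open>g' = f\<close> and both legs are identities. Each pair of legs is equal, so the
      reversal inside the pair is invisible.\<close>
    using mirror_eq_iff[OF assms(2,2) star_hom_ident star_hom_ident star_hom_ident assms(2,1)]
    by (simp add: left_ae_deterministic_iff[OF assms(1) star_hom_ghom[OF assms(2)]]
        right_ae_deterministic_iff[OF assms(1) star_hom_ghom[OF assms(2)]])
qed

text \<open>The middle leg is an output of the inner copy, out of reach of a.e. equality, which
  concerns only the left output of the outer copy. The two bracketings of the triple copy are used
  to bring \<open>h\<close> there.\<close>

lemma copy_copy_ae_middle:
  assumes "q \<in> star_hom T Y" "h \<in> star_hom Y Y"
    and equiv: "left_ae_equivalent Q q h (\<one> Y)" and det: "left_ae_deterministic Q q h"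
  shows "((\<one> Y \<otimes> h) \<otimes> \<one> Y) \<cdot> (\<Delta> Y \<otimes> \<one> Y) \<cdot> \<Delta> Y \<cdot> q = (\<Delta> Y \<otimes> \<one> Y) \<cdot> \<Delta> Y \<cdot> q"
proof -
  note [simp] = star_homD(1-4,6,7)[OF assms(1)] star_homD(1-4,6,7)[OF assms(2)]
  have equiv': "(h \<otimes> \<one> Y) \<cdot> (\<Delta> Y \<cdot> q) = \<Delta> Y \<cdot> q"
    using equiv left_ae_equivalent_iff[OF assms(1) assms(2)[THEN star_hom_ghom]
        star_hom_ident[THEN star_hom_ghom]]
    by (simp add: comp_assoc_Arr)
  have coassoc: "\<a> Y Y Y \<cdot> ((\<Delta> Y \<otimes> \<one> Y) \<cdot> (\<Delta> Y \<cdot> q)) = (\<one> Y \<otimes> \<Delta> Y) \<cdot> (\<Delta> Y \<cdot> q)"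
    using arg_cong[OF coassociative[of Y], of "\<lambda>k. k \<cdot> q"] by (simp add: comp_assoc_Arr)
  \<comment> \<open>Needed for \<open>x = \<one> Y\<close> and for \<open>x = h\<close>, that is,
    before and after \<open>h\<close> is inserted at the left leg.\<close>
  have assoc: "\<a> Y Y Y \<cdot> (((x \<otimes> h) \<otimes> \<one> Y) \<cdot> ((\<Delta> Y \<otimes> \<one> Y) \<cdot> (\<Delta> Y \<cdot> q)))
      = (x \<otimes> (h \<otimes> \<one> Y)) \<cdot> ((\<one> Y \<otimes> \<Delta> Y) \<cdot> (\<Delta> Y \<cdot> q))" if x: "x \<in> star_hom Y Y" for x
  proof -
    note [simp] = star_homD(1-4,6,7)[OF x]
    have "\<a> Y Y Y \<cdot> ((x \<otimes> h) \<otimes> \<one> Y) = (x \<otimes> (h \<otimes> \<one> Y)) \<cdot> \<a> Y Y Y"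
      using associator_natural[OF star_hom_ghom[OF x] assms(2)[THEN star_hom_ghom]
          star_hom_ident[THEN star_hom_ghom]]
      by simp
    then show ?thesis
      by (simp add: coassoc[symmetric] comp_assoc_Arr[symmetric])
  qed
  \<comment> \<open>In the right bracketing the leftmost leg is the left output of the outer copy,
    so \<open>equiv'\<close>, read backwards, inserts a second \<open>h\<close> there.\<close>
  have "(\<one> Y \<otimes> (h \<otimes> \<one> Y)) \<cdot> ((\<one> Y \<otimes> \<Delta> Y) \<cdot> (\<Delta> Y \<cdot> q))
    = (\<one> Y \<otimes> ((h \<otimes> \<one> Y) \<cdot> \<Delta> Y)) \<cdot> ((h \<otimes> \<one> Y) \<cdot> (\<Delta> Y \<cdot> q))"
    by (simp add: equiv' tensor_comp_Arr_assoc)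
  also have "\<dots> = (h \<otimes> (h \<otimes> \<one> Y)) \<cdot> ((\<one> Y \<otimes> \<Delta> Y) \<cdot> (\<Delta> Y \<cdot> q))"
    by (simp add: tensor_comp_Arr_assoc)
  finally have "\<a> Y Y Y \<cdot> (((\<one> Y \<otimes> h) \<otimes> \<one> Y) \<cdot> ((\<Delta> Y \<otimes> \<one> Y) \<cdot> (\<Delta> Y \<cdot> q)))
    = \<a> Y Y Y \<cdot> (((h \<otimes> h) \<otimes> \<one> Y) \<cdot> ((\<Delta> Y \<otimes> \<one> Y) \<cdot> (\<Delta> Y \<cdot> q)))"
    by (simp add: assoc assms(2) star_hom_ident)
  then have "((\<one> Y \<otimes> h) \<otimes> \<one> Y) \<cdot> ((\<Delta> Y \<otimes> \<one> Y) \<cdot> (\<Delta> Y \<cdot> q))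
    = ((h \<otimes> h) \<otimes> \<one> Y) \<cdot> ((\<Delta> Y \<otimes> \<one> Y) \<cdot> (\<Delta> Y \<cdot> q))"
    by (rule iso_cancel_left[OF associator_iso, rotated 3]) simp_all
  also have "\<dots> = ((\<Delta> Y \<cdot> h) \<otimes> \<one> Y) \<cdot> (\<Delta> Y \<cdot> q)"
    using det left_ae_deterministic_iff[OF assms(1) assms(2)[THEN star_hom_ghom]]
    by (simp add: comp_assoc_Arr)
  \<comment> \<open>Back in the left bracketing, determinism has merged both occurrences of
    \<open>h\<close> into one below the inner copy, where \<open>equiv'\<close> removes it.\<close>
  also have "\<dots> = (\<Delta> Y \<otimes> \<one> Y) \<cdot> ((h \<otimes> \<one> Y) \<cdot> (\<Delta> Y \<cdot> q))"
    by (simp add: tensor_comp_Arr_assoc)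
  finally show ?thesis by (simp add: equiv' comp_assoc_Arr)
qed

text \<open>The two-leg analogue of the mirror argument: starring both legs and swapping them turns
  the right composite into the left one preceded by \<open>\<star> T\<close>, which cancels.\<close>

lemma ae_equivalent_right_imp_left:
  assumes "q \<in> star_hom T X" "f \<in> star_hom X Y" "g \<in> star_hom X Y"
    and "right_ae_equivalent Q q f g"
  shows "left_ae_equivalent Q q f g"
proof -
  note [simp] = star_homD(1-4,6,7)[OF assms(1)] star_homD(1-4,6,7)[OF assms(2)]
    star_homD(1-4,6,7)[OF assms(3)]
  have reverse: "\<c> X Y \<cdot> ((\<star> X \<otimes> \<star> Y) \<cdot> ((\<one> X \<otimes> f) \<cdot> \<Delta> X \<cdot> q)) = ((f \<otimes> \<one> X) \<cdot> \<Delta> X \<cdot> q) \<cdot> \<star> T"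
    if f: "f \<in> star_hom X Y" for f
  proof -
    note [simp] = star_homD(1-4,6,7)[OF f]
    have "\<c> X Y \<cdot> ((\<star> X \<otimes> \<star> Y) \<cdot> ((\<one> X \<otimes> f) \<cdot> \<Delta> X \<cdot> q))
      = \<c> X Y \<cdot> ((\<one> X \<otimes> f) \<cdot> ((\<star> X \<otimes> \<star> X) \<cdot> (\<Delta> X \<cdot> q)))"
      by (simp add: comp_assoc_Arr tensor_comp_Arr_assoc star_homD(5)[OF f])
    also have "\<dots> = ((f \<otimes> \<one> X) \<cdot> \<Delta> X \<cdot> q) \<cdot> \<star> T"
      unfolding star_star_copy_comp[OF assms(1)]
      by (simp add: symmetry_natural_assoc symmetry_inverse_assoc comp_assoc_Arr)
    finally show ?thesis .
  qed
  note ghoms = assms(2,3)[THEN star_hom_ghom]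
  have "(\<one> X \<otimes> f) \<cdot> \<Delta> X \<cdot> q = (\<one> X \<otimes> g) \<cdot> \<Delta> X \<cdot> q"
    using assms(4) right_ae_equivalent_iff[OF assms(1) ghoms] by simp
  then have "((f \<otimes> \<one> X) \<cdot> \<Delta> X \<cdot> q) \<cdot> \<star> T = ((g \<otimes> \<one> X) \<cdot> \<Delta> X \<cdot> q) \<cdot> \<star> T"
    using reverse[OF assms(2)] reverse[OF assms(3)] by simp
  then have "(f \<otimes> \<one> X) \<cdot> \<Delta> X \<cdot> q = (g \<otimes> \<one> X) \<cdot> \<Delta> X \<cdot> q"
    by (rule star_cancel_right) simp_all
  then show ?thesis by (simp add: left_ae_equivalent_iff[OF assms(1) ghoms])
qed

lemma strictly_positive_left_iff_right:
  assumes C: "\<And>f. f \<in> C \<Longrightarrow> f \<in> star_hom (src Q f) (tgt Q f)"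
  shows "left_strictly_positive Q C \<longleftrightarrow> right_strictly_positive Q C"
proof -
  have C': "f \<in> star_hom X Y" if "f \<in> C \<inter> hom Q X Y" for f X Y
    using C that by (auto simp: hom_def)
  have "(left_ae_deterministic Q q (f \<cdot> g) \<longrightarrow>
        ((\<one> X \<otimes> f) \<otimes> \<one> Y) \<cdot> ((\<Delta> X \<cdot> g) \<otimes> \<one> Y) \<cdot> \<Delta> Y \<cdot> q
        = ((g \<otimes> (f \<cdot> g)) \<otimes> \<one> Y) \<cdot> (\<Delta> Y \<otimes> \<one> Y) \<cdot> \<Delta> Y \<cdot> q) \<longleftrightarrow>
      (right_ae_deterministic Q q (f \<cdot> g) \<longrightarrow>
        (\<one> Y \<otimes> (f \<otimes> \<one> X)) \<cdot> (\<one> Y \<otimes> (\<Delta> X \<cdot> g)) \<cdot> \<Delta> Y \<cdot> q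
        = (\<one> Y \<otimes> ((f \<cdot> g) \<otimes> g)) \<cdot> (\<one> Y \<otimes> \<Delta> Y) \<cdot> \<Delta> Y \<cdot> q)"
    if qgf: "q \<in> C \<inter> hom Q T Y" "g \<in> C \<inter> hom Q Y X" "f \<in> C \<inter> hom Q X Z" for T X Y Z q g f
  proof -
    note qgf' = qgf[THEN C']
    note [simp] = star_homD(6,7)[OF qgf'(2)]
    show ?thesis
      \<comment> \<open>The legs are \<open>\<one> X\<close> and \<open>f\<close> after copying the
        output of \<open>g\<close>, against \<open>g\<close> and \<open>f \<cdot> g\<close> after
        copying \<open>Y\<close> itself. The a.e. determinism hypotheses are exchanged as
        well.\<close>
      using mirror_eq_iff[OF star_hom_ident qgf'(3,2,2) star_hom_comp[OF qgf'(2,3)] star_hom_ident qgf'(1)]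
        ae_deterministic_left_iff_right[OF qgf'(1) star_hom_comp[OF qgf'(2,3)]]
      by simp
  qed
  then show ?thesis
    unfolding left_strictly_positive_def right_strictly_positive_def by blast
qed

lemma ae_modular_left_imp_right:
  assumes C: "\<And>f. f \<in> C \<Longrightarrow> f \<in> star_hom (src Q f) (tgt Q f)"
    and left: "left_ae_modular Q C"
  shows "right_ae_modular Q C"
  unfolding right_ae_modular_def
proof (intro allI ballI impI)
  fix T X Y f g q
  assume fgq: "f \<in> C \<inter> hom Q X Y" "g \<in> C \<inter> hom Q Y X" "q \<in> C \<inter> hom Q T Y"
    and equiv: "right_ae_equivalent Q q (f \<cdot> g) (\<one> Y)"
  have C': "f \<in> star_hom X Y" if "f \<in> C \<inter> hom Q X Y" for f X Y
    using C that by (auto simp: hom_def)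
  note fgq' = fgq[THEN C']
  note [simp] = star_homD(6,7)[OF fgq'(2)]
  have "left_ae_equivalent Q q (f \<cdot> g) (\<one> Y)"
    using ae_equivalent_right_imp_left[OF fgq'(3) star_hom_comp[OF fgq'(2,1)] star_hom_ident equiv]
    by simp
  then have "((\<one> X \<otimes> f) \<otimes> \<one> Y) \<cdot> ((\<Delta> X \<cdot> g) \<otimes> \<one> Y) \<cdot> \<Delta> Y \<cdot> q
        = ((g \<otimes> \<one> Y) \<otimes> \<one> Y) \<cdot> (\<Delta> Y \<otimes> \<one> Y) \<cdot> \<Delta> Y \<cdot> q"
    using left fgq unfolding left_ae_modular_def by blast
  then show "(\<one> Y \<otimes> (f \<otimes> \<one> X)) \<cdot> (\<one> Y \<otimes> (\<Delta> X \<cdot> g)) \<cdot> \<Delta> Y \<cdot> q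
        = (\<one> Y \<otimes> (\<one> Y \<otimes> g)) \<cdot> (\<one> Y \<otimes> \<Delta> Y) \<cdot> \<Delta> Y \<cdot> q"
    using mirror_eq_iff[OF star_hom_ident fgq'(1,2,2) star_hom_ident star_hom_ident fgq'(3)]
    by simp
qed

section \<open>A.e. modularity and S-positivity\<close>

lemma left_ae_modularI:
  assumes C: "\<And>f. f \<in> C \<Longrightarrow> f \<in> star_hom (src Q f) (tgt Q f)"
    and closed: "\<And>f g. \<lbrakk>f \<in> C; g \<in> C; tgt Q f = src Q g\<rbrakk> \<Longrightarrow> g \<cdot> f \<in> C"
    and reasonable: "deterministically_reasonable Q C"
    and positive: "left_strictly_positive Q C"
  shows "left_ae_modular Q C"
  unfolding left_ae_modular_def
proof (intro allI ballI impI)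
  fix T X Y f g q
  assume fgq: "f \<in> C \<inter> hom Q X Y" "g \<in> C \<inter> hom Q Y X" "q \<in> C \<inter> hom Q T Y"
    and equiv: "left_ae_equivalent Q q (f \<cdot> g) (\<one> Y)"
  have C': "f \<in> star_hom X Y" if "f \<in> C \<inter> hom Q X Y" for f X Y
    using C that by (auto simp: hom_def)
  note fgq' = fgq[THEN C']
  note fg = star_hom_comp[OF fgq'(2,1)]
  note [simp] = star_homD(1-4,6,7)[OF fgq'(1)] star_homD(1-4,6,7)[OF fgq'(2)]
    star_homD(1-4,6,7)[OF fgq'(3)]
  \<comment> \<open>Reasonableness speaks only of morphisms in \<open>C\<close>, hence the closure
    under composition. The deterministic comparison morphism is \<open>\<one> Y\<close>.\<close>
  have "f \<cdot> g \<in> C" using closed[of g f] fgq by auto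
  then have det: "left_ae_deterministic Q q (f \<cdot> g)"
    using reasonable equiv fgq deterministic_ident[of Y]
    unfolding deterministically_reasonable_def by auto
  then have "((\<one> X \<otimes> f) \<otimes> \<one> Y) \<cdot> ((\<Delta> X \<cdot> g) \<otimes> \<one> Y) \<cdot> \<Delta> Y \<cdot> q
      = ((g \<otimes> (f \<cdot> g)) \<otimes> \<one> Y) \<cdot> (\<Delta> Y \<otimes> \<one> Y) \<cdot> \<Delta> Y \<cdot> q"
    using positive fgq unfolding left_strictly_positive_def by blast
  \<comment> \<open>Interchange separates \<open>g\<close> on the left leg from
    \<open>f \<cdot> g\<close> on the middle leg, so that the latter can be absorbed into the
    copies.\<close>
  also have "\<dots> = ((g \<otimes> \<one> Y) \<otimes> \<one> Y) \<cdot> (((\<one> Y \<otimes> (f \<cdot> g)) \<otimes> \<one> Y) \<cdot> (\<Delta> Y \<otimes> \<one> Y) \<cdot> \<Delta> Y \<cdot> q)"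
    by (simp add: comp_assoc_Arr tensor_comp_Arr_assoc)
  also have "\<dots> = ((g \<otimes> \<one> Y) \<otimes> \<one> Y) \<cdot> (\<Delta> Y \<otimes> \<one> Y) \<cdot> \<Delta> Y \<cdot> q"
    unfolding copy_copy_ae_middle[OF fgq'(3) fg equiv det] by (simp add: comp_assoc_Arr)
  finally show "((\<one> X \<otimes> f) \<otimes> \<one> Y) \<cdot> ((\<Delta> X \<cdot> g) \<otimes> \<one> Y) \<cdot> \<Delta> Y \<cdot> q
      = ((g \<otimes> \<one> Y) \<otimes> \<one> Y) \<cdot> (\<Delta> Y \<otimes> \<one> Y) \<cdot> \<Delta> Y \<cdot> q" .
qed

text \<open>Naturality of the unitor moves \<open>k\<close> outside, where the left counit law
  applies. Thus \<open>k\<close> can be recovered from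
  \<open>(\<one> X \<otimes> k) \<cdot> \<Delta> X\<close>, that is, a.e. equality with respect to
  an identity is plain equality.\<close>

lemma discard_copy_left:
  assumes "k \<in> ghom Q 0 X Y"
  shows "\<l> Y \<cdot> ((\<epsilon> X \<otimes> \<one> Y) \<cdot> ((\<one> X \<otimes> k) \<cdot> \<Delta> X)) = k"
proof -
  have k: "k \<in> Arr Q" "src Q k = X" "tgt Q k = Y" "grade Q k = 0"
    using assms by (auto simp: ghom_def hom_def)
  have [simp]: "X \<in> Obj Q" "Y \<in> Obj Q" using k src_Obj tgt_Obj by auto
  have "\<l> Y \<cdot> ((\<epsilon> X \<otimes> \<one> Y) \<cdot> ((\<one> X \<otimes> k) \<cdot> \<Delta> X))
    = (\<l> Y \<cdot> (\<one> \<I> \<otimes> k)) \<cdot> ((\<epsilon> X \<otimes> \<one> X) \<cdot> \<Delta> X)"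
    using k by (simp add: comp_assoc_Arr tensor_comp_Arr_assoc)
  also have "\<dots> = k \<cdot> (\<l> X \<cdot> (\<epsilon> X \<otimes> \<one> X) \<cdot> \<Delta> X)"
    unfolding unitor_natural_even[OF assms] using k by (simp add: comp_assoc_Arr)
  finally show ?thesis using k by (simp add: counit_left)
qed

lemma S_positiveI:
  assumes C: "\<And>f. f \<in> C \<Longrightarrow> f \<in> star_hom (src Q f) (tgt Q f)"
    and ident: "\<And>f. f \<in> C \<Longrightarrow> \<one> (src Q f) \<in> C"
    and positive: "right_strictly_positive Q C"
  shows "S_positive Q C"
  unfolding S_positive_def
proof (intro allI ballI impI)
  fix X Y Z f g
  assume fg: "f \<in> C \<inter> hom Q X Y" "g \<in> C \<inter> hom Q Y Z" and det: "deterministic Q (g \<cdot> f)"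
  have C': "f \<in> star_hom X Y" if "f \<in> C \<inter> hom Q X Y" for f X Y
    using C that by (auto simp: hom_def)
  note fg' = fg[THEN C']
  note gf = star_hom_comp[OF fg']
  note [simp] = star_homD(1-4,6,7)[OF fg'(1)] star_homD(1-4,6,7)[OF fg'(2)]
  \<comment> \<open>Strict positivity is used with \<open>q = \<one> X\<close>; its \<open>g\<close>
    is the present \<open>f\<close> and its \<open>f\<close> the present \<open>g\<close>.\<close>
  have "\<one> X \<in> C \<inter> hom Q X X" using ident[of f] fg ident_hom[of X] by auto
  moreover have "right_ae_deterministic Q (\<one> X) (g \<cdot> f)"
    using det by (simp add: right_ae_deterministic_iff[OF star_hom_ident gf[THEN star_hom_ghom]]
        deterministic_def comp_assoc_Arr tensor_comp_Arr_assoc)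
  ultimately have "(\<one> X \<otimes> (g \<otimes> \<one> Y)) \<cdot> (\<one> X \<otimes> (\<Delta> Y \<cdot> f)) \<cdot> \<Delta> X \<cdot> \<one> X
      = (\<one> X \<otimes> ((g \<cdot> f) \<otimes> f)) \<cdot> (\<one> X \<otimes> \<Delta> X) \<cdot> \<Delta> X \<cdot> \<one> X"
    using positive fg unfolding right_strictly_positive_def by blast
  \<comment> \<open>The second and third legs are gathered into a single even morphism out of
    \<open>X\<close>, the \<open>k\<close> of \<open>discard_copy_left\<close>.\<close>
  then have "(\<one> X \<otimes> ((g \<otimes> \<one> Y) \<cdot> (\<Delta> Y \<cdot> f))) \<cdot> \<Delta> X = (\<one> X \<otimes> (((g \<cdot> f) \<otimes> f) \<cdot> \<Delta> X)) \<cdot> \<Delta> X"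
    by (simp add: tensor_comp_Arr_assoc tensor_comp_Arr)
  moreover have "(g \<otimes> \<one> Y) \<cdot> (\<Delta> Y \<cdot> f) \<in> ghom Q 0 X (Z \<odot> Y)"
    "((g \<cdot> f) \<otimes> f) \<cdot> \<Delta> X \<in> ghom Q 0 X (Z \<odot> Y)"
    by (simp_all add: ghom_def hom_def)
  ultimately have "(g \<otimes> \<one> Y) \<cdot> (\<Delta> Y \<cdot> f) = ((g \<cdot> f) \<otimes> f) \<cdot> \<Delta> X"
    by (metis discard_copy_left)
  then show "(g \<otimes> \<one> Y) \<cdot> \<Delta> Y \<cdot> f = ((g \<cdot> f) \<otimes> f) \<cdot> \<Delta> X"
    by (simp add: comp_assoc_Arr)
qed

end

theorem proposition8p29:
  fixes Q :: "('o, 'm, 'x) quantum_CD_category_scheme"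
    and CObj :: "'o set" and CArr :: "'m set"
  assumes "quantum_Markov_category Q"
    and "subcategory Q CObj CArr"
    and "even_subcategory Q CArr"
    and "star_preserving_subcategory Q CArr"
    and "deterministically_reasonable Q CArr"
    and "left_strictly_positive Q CArr \<or> right_strictly_positive Q CArr"
  shows "left_ae_modular Q CArr \<and> right_ae_modular Q CArr \<and> S_positive Q CArr"
proof -
  interpret quantum_Markov_category Q by fact
  interpret subcategory Q CObj CArr by fact
  have C: "f \<in> star_hom (src Q f) (tgt Q f)" if "f \<in> CArr" for f
    using that assms(3,4) by (auto simp: even_subcategory_def star_preserving_subcategory_def
        even_morphism_def star_hom_def ghom_def hom_def)
  \<comment> \<open>Whichever version is given, both are available: the left one yields modularity,
    the right one S-positivity.\<close>
  have left: "left_strictly_positive Q CArr" and right: "right_strictly_positive Q CArr"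
    using assms(6) strictly_positive_left_iff_right[OF C] by auto
  have "left_ae_modular Q CArr"
    using C comp_CArr assms(5) left by (rule left_ae_modularI)
  moreover have "right_ae_modular Q CArr"
    using C calculation by (rule ae_modular_left_imp_right)
  moreover have "S_positive Q CArr"
    using C ident_CArr[OF src_CObj] right by (rule S_positiveI)
  ultimately show ?thesis by blast
qed

end
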